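(* Let $n\ge 2$ and let $X\subset\mathbb P^{2n-1}=\mathbb P(V)$ be a projective subvariety, possibly reducible, of codimension two. Assume that $X$ is contained in a hyperplane $H$ and has degree $m\ge 2$ as a hypersurface of $H$. Then the following are equivalent: (i) $X$ is involutive; (ii) $X$ is a cone whose vertex contains the polar point $\sigma(H)$.
   Context: We work over $\mathbb C$. Let $V=\mathbb C^{2n}$ with coordinates $(x_1,\dots,x_n,y_1,\dots,y_n)$, standard symplectic form $\omega=\sum_{i=1}^n dx_i\wedge dy_i$, and Poisson bracket on $\mathbb C[V]$ $$\{f,g\}=\sum_{i=1}^n\left(\frac{\partial f}{\partial x_i}\frac{\partial g}{\partial y_i}-\frac{\partial f}{\partial y_i}\frac{\partial g}{\partial x_i}\right).$$ A (possibly reducible) projective algebraic subvariety $X\subset\mathbb P(V)$ with saturated homogeneous ideal $I(X)\subset\mathbb C[V]$ is called involutive if $\{I(X),I(X)\}\subset I(X)$. Polar point: a hyperplane $H=V(\ell)\subset\mathbb P(V)$, with $\ell$ a nonzero linear form, determines up to scalar the vector $v_\ell\in V$ with $\ell(u)=\omega(v_\ell,u)$ for all $u\in V$; set $\sigma(H)=[v_\ell]\in\mathbb P(V)$. One has $\sigma(H)\in H$. Cone: let $H\simeq\mathbb P^r$ be a hyperplane, $p\in H$, and $X=V_H(F)\subset H$ a projective hypersurface of $H$. $X$ is a cone whose vertex contains $p$ if, after choosing homogeneous coordinates $[z_0:\dots:z_r]$ on $H$ with $p=[1:0:\dots:0]$, the equation $F$ is independent of $z_0$; equivalently, every line joining $p$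 to a point of $X$ is contained in $X$. *)

theory Defs
  imports "HOL-Analysis.Analysis" "HOL-Library.Poly_Mapping"
begin

type_synonym 'v cpoly = "('v \<Rightarrow>\<^sub>0 nat) \<Rightarrow>\<^sub>0 complex"

definition peval :: "('v::finite) cpoly \<Rightarrow> complex ^ 'v \<Rightarrow> complex" where
  "peval f u = (\<Sum>a\<in>Poly_Mapping.keys f.
     Poly_Mapping.lookup f a * (\<Prod>i\<in>UNIV. (u $ i) ^ Poly_Mapping.lookup a i))"

definition form :: "nat \<Rightarrow> ('v::finite) cpoly \<Rightarrow> bool" where
  "form d f \<longleftrightarrow> (\<forall>a\<in>Poly_Mapping.keys f. (\<Sum>i\<in>UNIV. Poly_Mapping.lookup a i) = d)"

text \<open>The formal partial derivative. The truncated subtraction on exponents is harmless: where it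
  truncates, the coefficient vanishes.\<close>

definition partial :: "'v \<Rightarrow> ('v::finite) cpoly \<Rightarrow> 'v cpoly" where
  "partial i f = (\<Sum>a\<in>Poly_Mapping.keys f.
     Poly_Mapping.single (a - Poly_Mapping.single i 1)
       (of_nat (Poly_Mapping.lookup a i) * Poly_Mapping.lookup f a))"

text \<open>A point of \<open>P(V)\<close> is a one-dimensional linear subspace of \<open>V\<close>, so subsets of \<open>P(V)\<close> are sets
  of sets of vectors and \<open>\<Union>X\<close> is the affine cone over \<open>X\<close>.\<close>

definition proj_point :: "complex ^ 'v \<Rightarrow> (complex ^ 'v::finite) set" where
  "proj_point v = vec.span {v}"

definition proj_space :: "(complex ^ 'v::finite) set set" where
  "proj_space = {proj_point v | v. v \<noteq> 0}"

definition zero_locus :: "('v::finite) cpoly set \<Rightarrow> (complex ^ 'v) set set" where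
  "zero_locus S = {p \<in> proj_space. \<forall>f\<in>S. \<forall>u\<in>p. peval f u = 0}"

text \<open>Possibly reducible projective varieties, that is, the Zariski closed subsets of \<open>P(V)\<close>.\<close>

definition proj_variety :: "(complex ^ 'v::finite) set set \<Rightarrow> bool" where
  "proj_variety X \<longleftrightarrow> (\<exists>S. (\<forall>f\<in>S. \<exists>d. form d f) \<and> X = zero_locus S)"

definition vanishing_ideal :: "(complex ^ 'v::finite) set set \<Rightarrow> 'v cpoly set" where
  "vanishing_ideal X = {f. \<forall>p\<in>X. \<forall>u\<in>p. peval f u = 0}"

definition irreducible_variety :: "(complex ^ 'v::finite) set set \<Rightarrow> bool" where
  "irreducible_variety Z \<longleftrightarrow> proj_variety Z \<and> Z \<noteq> {} \<and>
     (\<forall>A B. proj_variety A \<and> proj_variety B \<and> Z = A \<union> B \<longrightarrow> Z = A \<or> Z = B)"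

definition irreducible_chain :: "(complex ^ 'v::finite) set set \<Rightarrow> nat \<Rightarrow> bool" where
  "irreducible_chain X d \<longleftrightarrow> (\<exists>Z :: nat \<Rightarrow> (complex ^ 'v) set set.
     (\<forall>i\<le>d. irreducible_variety (Z i) \<and> Z i \<subseteq> X) \<and> (\<forall>i<d. Z i \<subset> Z (Suc i)))"

text \<open>Krull dimension for the Zariski topology, as a relation.\<close>

definition has_dim :: "(complex ^ 'v::finite) set set \<Rightarrow> nat \<Rightarrow> bool" where
  "has_dim X d \<longleftrightarrow> irreducible_chain X d \<and> \<not> irreducible_chain X (Suc d)"

definition has_codim :: "(complex ^ 'v::finite) set set \<Rightarrow> nat \<Rightarrow> bool" where
  "has_codim X c \<longleftrightarrow>
     (\<exists>d e. has_dim X d \<and> has_dim (proj_space :: (complex ^ 'v) set set) e \<and> e = d + c)"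

definition hyperplane :: "(complex ^ 'v::finite) set set \<Rightarrow> bool" where
  "hyperplane H \<longleftrightarrow> (\<exists>l. form 1 l \<and> l \<noteq> 0 \<and> H = zero_locus {l})"

text \<open>\<open>F\<close> is an equation of \<open>X = V\<^sub>H(F)\<close> of degree \<open>m\<close>: its class in the homogeneous coordinate ring
  \<open>C[V]/I(H)\<close> of \<open>H\<close> is nonzero and generates the ideal of \<open>X\<close> there. As \<open>X\<close> is reduced, taking a
  generator of the ideal, and not just any form cutting out \<open>X\<close>, is what makes \<open>m\<close> the degree
  of \<open>X\<close>.\<close>

definition hypersurface_equation ::
  "(complex ^ 'v::finite) set set \<Rightarrow> (complex ^ 'v) set set \<Rightarrow> nat \<Rightarrow> 'v cpoly \<Rightarrow> bool" where
  "hypersurface_equation H X m F \<longleftrightarrow> form m F \<and> F \<notin> vanishing_ideal H \<and>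
     X = H \<inter> zero_locus {F} \<and>
     vanishing_ideal X = {g + h * F | g h. g \<in> vanishing_ideal H}"

definition hypersurface_of_degree ::
  "(complex ^ 'v::finite) set set \<Rightarrow> (complex ^ 'v) set set \<Rightarrow> nat \<Rightarrow> bool" where
  "hypersurface_of_degree H X m \<longleftrightarrow> (\<exists>F. hypersurface_equation H X m F)"

text \<open>Homogeneous coordinates \<open>[z\<^sub>0 : \<dots> : z\<^sub>r]\<close> on \<open>H\<close> are given by a basis \<open>b\<^sub>0, \<dots>, b\<^sub>r\<close> of the linear
  subspace \<open>\<Union>H\<close>; the point \<open>[1 : 0 : \<dots> : 0]\<close> is then the one spanned by \<open>b\<^sub>0\<close>.\<close>

definition homogeneous_coordinates ::
  "(complex ^ 'v::finite) set set \<Rightarrow> nat \<Rightarrow> (nat \<Rightarrow> complex ^ 'v) \<Rightarrow> bool" where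
  "homogeneous_coordinates H r b \<longleftrightarrow>
     inj_on b {..r} \<and> vec.independent (b ` {..r}) \<and> vec.span (b ` {..r}) = \<Union>H"

definition cone_with_vertex_containing ::
  "(complex ^ 'v::finite) set set \<Rightarrow> (complex ^ 'v) set set \<Rightarrow> (complex ^ 'v) set \<Rightarrow> bool" where
  "cone_with_vertex_containing H X p \<longleftrightarrow> (\<exists>m F r b.
     hypersurface_equation H X m F \<and> homogeneous_coordinates H r b \<and> p = proj_point (b 0) \<and>
     (\<forall>z z'. (\<forall>i\<in>{1..r}. z i = z' i) \<longrightarrow>
        peval F (\<Sum>i\<le>r. z i *s b i) = peval F (\<Sum>i\<le>r. z' i *s b i)))"

text \<open>From here on \<open>V = C\<^sup>2\<^sup>n\<close> with \<open>n = CARD('n)\<close>; the coordinates \<open>x\<^sub>i\<close> and \<open>y\<^sub>i\<close> have the indices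
  \<open>Inl i\<close> and \<open>Inr i\<close>.\<close>

definition symplectic :: "complex ^ ('n::finite + 'n) \<Rightarrow> complex ^ ('n + 'n) \<Rightarrow> complex" where
  "symplectic u v = (\<Sum>i\<in>UNIV. u $ Inl i * v $ Inr i - u $ Inr i * v $ Inl i)"

definition poisson :: "('n::finite + 'n) cpoly \<Rightarrow> ('n + 'n) cpoly \<Rightarrow> ('n + 'n) cpoly" where
  "poisson f g = (\<Sum>i\<in>UNIV.
     partial (Inl i) f * partial (Inr i) g - partial (Inr i) f * partial (Inl i) g)"

definition involutive :: "(complex ^ ('n::finite + 'n)) set set \<Rightarrow> bool" where
  "involutive X \<longleftrightarrow>
     (\<forall>f\<in>vanishing_ideal X. \<forall>g\<in>vanishing_ideal X. poisson f g \<in> vanishing_ideal X)"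

definition polar_point :: "(complex ^ ('n::finite + 'n)) set set \<Rightarrow> (complex ^ ('n + 'n)) set" where
  "polar_point H = (THE p. \<exists>l v. form 1 l \<and> l \<noteq> 0 \<and> H = zero_locus {l} \<and>
     (\<forall>u. peval l u = symplectic v u) \<and> p = proj_point v)"

end

theory Submission imports Defs begin

text \<open>Write \<open>H = V(l)\<close> with \<open>l = \<omega>(v, \<cdot>)\<close>, so that \<open>[v]\<close> is the polar point, and let \<open>F\<close> be an
  equation of \<open>X\<close> in \<open>H\<close>. The Hamiltonian vector field of \<open>l\<close> is constant: \<open>{l, f} = - \<partial>\<^sub>v f\<close> for every
  polynomial \<open>f\<close>. Both conditions of the theorem turn out to say that \<open>\<partial>\<^sub>v F\<close> vanishes on \<open>H\<close>.

  For cones this is \<open>cone_iff_directional_derivative_zero\<close>: \<open>F\<close> is independent of the coordinate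
  belonging to \<open>v\<close> if and only if its derivative in that direction is zero on \<open>H\<close>.

  If \<open>X\<close> is involutive, then \<open>{l, F}\<close> lies in the ideal of \<open>X\<close>, so on \<open>H\<close> it is a multiple \<open>h F\<close> of
  \<open>F\<close>. Its degree is smaller than that of \<open>F\<close>, hence it is zero on \<open>H\<close>
  (\<open>involutive_imp_directional_derivative_zero\<close>). Conversely, at a point of \<open>X\<close> the differential of an
  element of the ideal is a combination of \<open>dl\<close> and \<open>dF\<close>, so the bracket of two such elements is a
  multiple of \<open>{l, F} = - \<partial>\<^sub>v F = 0\<close> there (\<open>directional_derivative_zero_imp_involutive\<close>).

  Membership in the ideal of \<open>X\<close> is a condition on values, so all arguments work with the values of
  polynomials and of their gradients at points of the affine cones.\<close>

section \<open>Evaluation of polynomials\<close>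

lemma poly_mapping_eq_sum_single:
  "f = (\<Sum>a\<in>Poly_Mapping.keys f. Poly_Mapping.single a (Poly_Mapping.lookup f a))"
  by (rule poly_mapping_eqI)
    (simp add: lookup_sum lookup_single when_def in_keys_iff)

lemma peval_single:
  "peval (Poly_Mapping.single a c) u = c * (\<Prod>i\<in>UNIV. (u $ i) ^ Poly_Mapping.lookup a i)"
  by (simp add: peval_def)

lemma peval_add: "peval (f + g) u = peval f u + peval g u"
  unfolding peval_def by (rule setsum_keys_plus_distrib) (simp_all add: algebra_simps)

lemma peval_zero [simp]: "peval 0 u = 0"
  by (simp add: peval_def)

lemma peval_sum: "peval (sum f A) u = (\<Sum>x\<in>A. peval (f x) u)"
  by (induction A rule: infinite_finite_induct) (simp_all add: peval_add)

lemma peval_diff: "peval (f - g) u = peval f u - peval g u"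
  using peval_add[of "f - g" g u] by simp

lemma peval_mult: "peval (f * g) u = peval f u * peval g u"
proof -
  have single: "peval (Poly_Mapping.single a c * Poly_Mapping.single b d) u
      = peval (Poly_Mapping.single a c) u * peval (Poly_Mapping.single b d) u" for a b c d
    by (simp add: mult_single peval_single lookup_add power_add prod.distrib)
  have "peval (f * g) u
      = peval ((\<Sum>a\<in>Poly_Mapping.keys f. Poly_Mapping.single a (Poly_Mapping.lookup f a))
          * (\<Sum>b\<in>Poly_Mapping.keys g. Poly_Mapping.single b (Poly_Mapping.lookup g b))) u"
    by (simp only: poly_mapping_eq_sum_single[symmetric])
  also have "\<dots> = peval (\<Sum>a\<in>Poly_Mapping.keys f. Poly_Mapping.single a (Poly_Mapping.lookup f a)) u
      * peval (\<Sum>b\<in>Poly_Mapping.keys g. Poly_Mapping.single b (Poly_Mapping.lookup g b)) u"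
    by (simp only: sum_product peval_sum single)
  finally show ?thesis
    by (simp only: poly_mapping_eq_sum_single[symmetric])
qed

lemma peval_scale_form:
  assumes "form d f"
  shows "peval f (c *s u) = c ^ d * peval f u"
proof -
  have "(\<Prod>i\<in>UNIV. (c * u $ i) ^ Poly_Mapping.lookup a i)
      = c ^ d * (\<Prod>i\<in>UNIV. (u $ i) ^ Poly_Mapping.lookup a i)"
    if "a \<in> Poly_Mapping.keys f" for a
  proof -
    have "d = (\<Sum>i\<in>UNIV. Poly_Mapping.lookup a i)"
      using assms that by (simp add: form_def)
    then show ?thesis
      by (simp add: power_mult_distrib prod.distrib power_sum)
  qed
  then show ?thesis
    by (simp add: peval_def sum_distrib_left mult.left_commute)
qed

text \<open>A monomial of degree one is a coordinate, so the value of a linear form at a standard basis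
  vector is one of its coefficients. Hence the polar vector of a hyperplane is not zero.\<close>

lemma linear_form_nonzero_value:
  assumes l: "form 1 l" and "l \<noteq> 0"
  obtains u where "peval l u \<noteq> 0"
proof -
  have mono: "\<exists>i. a = Poly_Mapping.single i 1" if "a \<in> Poly_Mapping.keys l" for a
  proof -
    have "(\<Sum>i\<in>UNIV. Poly_Mapping.lookup a i) = 1"
      using l that by (simp add: form_def)
    then obtain i where i: "Poly_Mapping.lookup a i = 1"
      "\<And>j. j \<noteq> i \<Longrightarrow> Poly_Mapping.lookup a j = 0"
      by (auto simp: sum_eq_Suc0_iff)
    then have "a = Poly_Mapping.single i 1"
      by (intro poly_mapping_eqI) (auto simp: lookup_single when_def)
    then show ?thesis ..
  qed
  obtain a where a: "a \<in> Poly_Mapping.keys l"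
    using \<open>l \<noteq> 0\<close> by (metis all_not_in_conv keys_eq_empty)
  then obtain i where i: "a = Poly_Mapping.single i 1"
    using mono by blast
  have val: "(\<Prod>j\<in>UNIV. (axis i (1::complex) $ j) ^ Poly_Mapping.lookup b j) = (if b = a then 1 else 0)"
    if b: "b \<in> Poly_Mapping.keys l" for b
  proof -
    obtain k where k: "b = Poly_Mapping.single k 1"
      using mono[OF b] by blast
    show ?thesis
    proof (cases "k = i")
      case True
      then show ?thesis
        by (auto simp: k i lookup_single when_def axis_def intro!: prod.neutral)
    next
      case False
      then have "b \<noteq> a"
        by (metis i k lookup_single_eq lookup_single_not_eq zero_neq_one)
      moreover have "(\<Prod>j\<in>UNIV. (axis i (1::complex) $ j) ^ Poly_Mapping.lookup b j) = 0"
        using False by (intro prod_zero bexI[of _ k]) (auto simp: k axis_def)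
      ultimately show ?thesis by simp
    qed
  qed
  have "peval l (axis i 1) = Poly_Mapping.lookup l a"
    using a by (simp add: peval_def val if_distrib cong: if_cong)
  then show ?thesis
    using a that[of "axis i 1"] by (simp add: in_keys_iff)
qed

section \<open>Gradients and directional derivatives\<close>

definition gradient :: "('v::finite) cpoly \<Rightarrow> complex ^ 'v \<Rightarrow> complex ^ 'v" where
  "gradient f u = (\<chi> i. peval (partial i f) u)"

lemma peval_partial:
  "peval (partial i f) u = (\<Sum>a\<in>Poly_Mapping.keys f. Poly_Mapping.lookup f a *
     (of_nat (Poly_Mapping.lookup a i) * (u $ i) ^ (Poly_Mapping.lookup a i - 1) *
       (\<Prod>j\<in>UNIV - {i}. (u $ j) ^ Poly_Mapping.lookup a j)))"
proof -
  have "(\<Prod>j\<in>UNIV. (u $ j) ^ Poly_Mapping.lookup (a - Poly_Mapping.single i 1) j)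
      = (u $ i) ^ (Poly_Mapping.lookup a i - 1) * (\<Prod>j\<in>UNIV - {i}. (u $ j) ^ Poly_Mapping.lookup a j)"
    for a
    by (subst prod.remove[of _ i])
      (auto simp: lookup_minus lookup_single when_def intro!: prod.cong)
  then show ?thesis
    by (simp add: partial_def peval_sum peval_single algebra_simps)
qed

text \<open>This connects the formal partial derivatives with analysis. Directional derivatives along
  complex lines then give the product rule, constancy along lines and the Euler-type scaling relation
  without further computations with exponents.\<close>

lemma has_field_derivative_peval_line:
  "((\<lambda>t. peval f (u + t *s w)) has_field_derivative
     scalar_product (gradient f (u + t *s w)) w) (at t)"
proof -
  let ?x = "u + t *s w"
  have coord: "((\<lambda>t. ((u + t *s w) $ i) ^ k) has_field_derivative
      of_nat k * (?x $ i) ^ (k - 1) * w $ i) (at t)" for i k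
    by (auto intro!: derivative_eq_intros)
  have "((\<lambda>t. peval f (u + t *s w)) has_field_derivative
      (\<Sum>a\<in>Poly_Mapping.keys f. Poly_Mapping.lookup f a *
        (\<Sum>i\<in>UNIV. of_nat (Poly_Mapping.lookup a i) * (?x $ i) ^ (Poly_Mapping.lookup a i - 1) * w $ i *
          (\<Prod>j\<in>UNIV - {i}. (?x $ j) ^ Poly_Mapping.lookup a j)))) (at t)"
    unfolding peval_def
    by (intro DERIV_sum DERIV_cmult has_field_derivative_prod coord)
  also have "(\<Sum>a\<in>Poly_Mapping.keys f. Poly_Mapping.lookup f a *
        (\<Sum>i\<in>UNIV. of_nat (Poly_Mapping.lookup a i) * (?x $ i) ^ (Poly_Mapping.lookup a i - 1) * w $ i *
          (\<Prod>j\<in>UNIV - {i}. (?x $ j) ^ Poly_Mapping.lookup a j)))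
      = scalar_product (gradient f ?x) w"
    unfolding scalar_product_def gradient_def vec_lambda_beta peval_partial sum_distrib_left
      sum_distrib_right
    by (subst sum.swap) (simp add: mult_ac)
  finally show ?thesis .
qed

lemma directional_derivative_at_base:
  "((\<lambda>t. peval f (u + t *s w)) has_field_derivative scalar_product (gradient f u) w) (at 0)"
  using has_field_derivative_peval_line[of f u w 0] by simp

lemma directional_derivative_eq_zeroI:
  assumes "\<And>t. peval f (u + t *s w) = c"
  shows "scalar_product (gradient f u) w = 0"
proof (rule DERIV_unique)
  show "((\<lambda>t. peval f (u + t *s w)) has_field_derivative scalar_product (gradient f u) w) (at 0)"
    by (rule directional_derivative_at_base)
  show "((\<lambda>t. peval f (u + t *s w)) has_field_derivative 0) (at 0)"
    by (simp add: assms)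
qed

lemma scalar_product_axis: "scalar_product a (axis i 1) = a $ i"
  by (simp add: scalar_product_def axis_def if_distrib cong: if_cong)

lemma gradient_eqI:
  assumes "\<And>w. ((\<lambda>t. peval f (u + t *s w)) has_field_derivative scalar_product a w) (at 0)"
  shows "gradient f u = a"
proof -
  have "scalar_product (gradient f u) (axis i 1) = scalar_product a (axis i 1)" for i
    by (rule DERIV_unique[OF directional_derivative_at_base assms])
  then show ?thesis
    by (simp add: scalar_product_axis vec_eq_iff)
qed

lemma gradient_add: "gradient (f + g) u = gradient f u + gradient g u"
proof (rule gradient_eqI)
  fix w
  have "((\<lambda>t. peval (f + g) (u + t *s w)) has_field_derivative
      scalar_product (gradient f u) w + scalar_product (gradient g u) w) (at 0)"
    unfolding peval_add by (intro DERIV_add directional_derivative_at_base)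
  then show "((\<lambda>t. peval (f + g) (u + t *s w)) has_field_derivative
      scalar_product (gradient f u + gradient g u) w) (at 0)"
    by (simp add: scalar_product_def distrib_right sum.distrib)
qed

lemma gradient_mult: "gradient (f * g) u = peval g u *s gradient f u + peval f u *s gradient g u"
proof (rule gradient_eqI)
  fix w
  have "((\<lambda>t. peval (f * g) (u + t *s w)) has_field_derivative
      scalar_product (gradient f u) w * peval g (u + 0 *s w)
        + scalar_product (gradient g u) w * peval f (u + 0 *s w)) (at 0)"
    unfolding peval_mult by (intro DERIV_mult directional_derivative_at_base)
  then show "((\<lambda>t. peval (f * g) (u + t *s w)) has_field_derivative
      scalar_product (peval g u *s gradient f u + peval f u *s gradient g u) w) (at 0)"
    by (simp add: scalar_product_def algebra_simps sum.distrib sum_distrib_left)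
qed

lemma scalar_product_add_scale:
  fixes a :: "complex ^ 'v"
  shows "scalar_product a (u + c *s w) = scalar_product a u + c * scalar_product a w"
  by (simp add: scalar_product_def distrib_left sum.distrib sum_distrib_left mult.left_commute)

lemma scalar_product_commute:
  fixes a b :: "complex ^ 'v"
  shows "scalar_product a b = scalar_product b a"
  by (simp add: scalar_product_def mult.commute)

lemma covector_proportional:
  fixes a b :: "complex ^ ('v::finite)"
  assumes b: "b \<noteq> 0" and ker: "\<And>w. scalar_product b w = 0 \<Longrightarrow> scalar_product a w = 0"
  obtains c where "a = c *s b"
proof -
  obtain k where k: "b $ k \<noteq> 0"
    using b by (auto simp: vec_eq_iff)
  have pick: "scalar_product d (0 + x *s axis i 1 + y *s axis k 1) = x * d $ i + y * d $ k"
    for d :: "complex ^ 'v" and x y i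
    unfolding scalar_product_add_scale scalar_product_axis by (simp add: scalar_product_def)
  \<comment> \<open>The vectors \<open>b\<^sub>k e\<^sub>i - b\<^sub>i e\<^sub>k\<close> lie in the kernel of \<open>b\<close>; on them \<open>a\<close> takes the values of the
    two-by-two minors of \<open>a\<close> and \<open>b\<close>.\<close>
  have "a $ i * b $ k = a $ k * b $ i" for i
  proof -
    have "scalar_product b (0 + b $ k *s axis i 1 + (- b $ i) *s axis k 1) = 0"
      unfolding pick by simp
    from ker[OF this] show ?thesis
      unfolding pick by (simp add: mult.commute)
  qed
  then have "a = (a $ k / b $ k) *s b"
    using k by (simp add: vec_eq_iff field_simps)
  then show ?thesis by (rule that)
qed

text \<open>Compare derivatives on both sides of \<open>F (c u + t c w) = c\<^sup>m F (u + t w)\<close>; the extra factor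
  \<open>c\<close> on the left avoids the exponent \<open>m - 1\<close>.\<close>

lemma gradient_scale_form:
  assumes "form m F"
  shows "c * scalar_product (gradient F (c *s u)) w = c ^ m * scalar_product (gradient F u) w"
proof (rule DERIV_unique)
  have "scalar_product (gradient F (c *s u)) (c *s w) = c * scalar_product (gradient F (c *s u)) w"
    by (simp add: scalar_product_def sum_distrib_left mult_ac)
  with directional_derivative_at_base[of F "c *s u" "c *s w"]
  show "((\<lambda>t. peval F (c *s u + t *s (c *s w))) has_field_derivative
      c * scalar_product (gradient F (c *s u)) w) (at 0)"
    by simp
  have "peval F (c *s u + t *s (c *s w)) = c ^ m * peval F (u + t *s w)" for t
  proof -
    have "c *s u + t *s (c *s w) = c *s (u + t *s w)"
      by (simp add: vec_eq_iff algebra_simps)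
    then show ?thesis
      by (simp only: peval_scale_form[OF assms])
  qed
  then show "((\<lambda>t. peval F (c *s u + t *s (c *s w))) has_field_derivative
      c ^ m * scalar_product (gradient F u) w) (at 0)"
    by (simp add: DERIV_cmult directional_derivative_at_base)
qed

lemma peval_line_constant:
  assumes "\<And>t. scalar_product (gradient F (u + t *s w)) w = 0"
  shows "peval F (u + t *s w) = peval F u"
proof -
  have "\<exists>c. \<forall>t\<in>UNIV. peval F (u + t *s w) = c"
    using has_field_derivative_peval_line[of F u w]
    by (intro has_field_derivative_zero_constant) (simp_all add: assms)
  then obtain c where "\<And>t. peval F (u + t *s w) = c"
    by blast
  from this[of t] this[of 0] show ?thesis by simp
qed

text \<open>If \<open>\<partial>\<^sub>w F = h F\<close> along the line through \<open>0\<close> and \<open>u\<close>, then degrees force \<open>h F\<close> to vanish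
  there: replacing \<open>u\<close> by \<open>t u\<close> and cancelling \<open>t\<^sup>m\<close> gives \<open>\<partial>\<^sub>w F (u) = t h (t u) F (u)\<close> for every
  \<open>t \<noteq> 0\<close>, and the right-hand side tends to \<open>0\<close> with \<open>t\<close>.\<close>

lemma directional_derivative_eq_zero_if_multiple:
  assumes F: "form m F"
    and mult: "\<And>t. scalar_product (gradient F (t *s u)) w = peval h (t *s u) * peval F (t *s u)"
  shows "scalar_product (gradient F u) w = 0"
proof -
  let ?r = "\<lambda>t. t * peval h (0 + t *s u) * peval F u"
  have "isCont ?r 0"
    using DERIV_isCont[OF directional_derivative_at_base[of h 0 u]] by (intro continuous_intros)
  then have "?r \<midarrow>0\<rightarrow> 0"
    by (simp add: isCont_def)
  moreover have "?r t = scalar_product (gradient F u) w" if "t \<noteq> 0" for t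
  proof -
    have "t ^ m * scalar_product (gradient F u) w = t * (peval h (t *s u) * (t ^ m * peval F u))"
      using gradient_scale_form[OF F, of t u w] by (simp only: mult peval_scale_form[OF F])
    then have "t ^ m * scalar_product (gradient F u) w = t ^ m * ?r t"
      by (simp only: mult_ac add_0)
    then show ?thesis using that by simp
  qed
  then have "?r \<midarrow>0\<rightarrow> scalar_product (gradient F u) w"
    by (intro tendsto_eventually) (auto simp: eventually_at_filter)
  ultimately show ?thesis
    using LIM_unique by blast
qed

section \<open>Cones\<close>

text \<open>Independence of the coordinate along \<open>v\<close> is recognised infinitesimally. The equation \<open>F\<close> on the
  right is not fixed in advance because a cone comes with an equation of its own.\<close>

lemma cone_iff_directional_derivative_zero:
  assumes sub: "vec.subspace (\<Union>H)" and v: "v \<in> \<Union>H" and "v \<noteq> 0"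
  shows "cone_with_vertex_containing H X (proj_point v) \<longleftrightarrow>
    (\<exists>m F. hypersurface_equation H X m F \<and> (\<forall>u\<in>\<Union>H. scalar_product (gradient F u) v = 0))"
    (is "?L \<longleftrightarrow> ?R")
proof
  assume ?L
  then obtain m F r b where F: "hypersurface_equation H X m F"
    and b: "homogeneous_coordinates H r b" and v_b: "proj_point v = proj_point (b 0)"
    and indep: "\<forall>z z'. (\<forall>i\<in>{1..r}. z i = z' i) \<longrightarrow>
        peval F (\<Sum>i\<le>r. z i *s b i) = peval F (\<Sum>i\<le>r. z' i *s b i)"
    unfolding cone_with_vertex_containing_def by blast
  have "v \<in> proj_point (b 0)"
    unfolding v_b[symmetric] by (simp add: proj_point_def vec.span_base)
  \<comment> \<open>Equality of projective points determines \<open>b\<^sub>0\<close> only up to a scalar.\<close>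
  then obtain c where c: "v = c *s b 0"
    by (auto simp: proj_point_def vec.span_singleton)
  have "scalar_product (gradient F u) v = 0" if "u \<in> \<Union>H" for u
  proof (rule directional_derivative_eq_zeroI)
    fix t
    have "u \<in> vec.span (b ` {..r})"
      using b that by (simp add: homogeneous_coordinates_def)
    then obtain k where "u = (\<Sum>x\<in>b ` {..r}. k x *s x)"
      by (auto simp: vec.span_finite)
    then have u: "u = (\<Sum>i\<le>r. k (b i) *s b i)"
      using b by (simp add: homogeneous_coordinates_def sum.reindex)
    let ?z = "\<lambda>i. k (b i) + (if i = 0 then t * c else 0)"
    have "(if i = 0 then t * c else 0) *s b i = (if i = 0 then t *s v else 0)" for i
      by (simp add: c)
    then have "(\<Sum>i\<le>r. (if i = 0 then t * c else 0) *s b i) = t *s v"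
      by (simp only:) simp
    then have "u + t *s v = (\<Sum>i\<le>r. ?z i *s b i)"
      by (simp only: u vec.scale_left_distrib sum.distrib)
    moreover have "peval F (\<Sum>i\<le>r. ?z i *s b i) = peval F (\<Sum>i\<le>r. k (b i) *s b i)"
      by (rule indep[rule_format]) simp
    ultimately show "peval F (u + t *s v) = peval F u"
      by (simp only: u[symmetric])
  qed
  with F show ?R by blast
next
  assume ?R
  then obtain m F where F: "hypersurface_equation H X m F"
    and D: "\<forall>u\<in>\<Union>H. scalar_product (gradient F u) v = 0"
    by blast
  \<comment> \<open>Suitable coordinates come from extending \<open>v\<close> to a basis of the linear subspace over \<open>H\<close>.\<close>
  have "vec.independent {v}"
    using \<open>v \<noteq> 0\<close> by (simp add: vec.independent_insert)
  then obtain B where B: "{v} \<subseteq> B" "B \<subseteq> \<Union>H" "vec.independent B" "\<Union>H \<subseteq> vec.span B"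
    by (rule vec.maximal_independent_subset_extend[of "{v}" "\<Union>H", rotated]) (use v in auto)
  then have "finite B"
    by (intro vec.finiteI_independent)
  then obtain e where e: "bij_betw e {1..card (B - {v})} (B - {v})"
    using ex_bij_betw_nat_finite_1[of "B - {v}"] by auto
  let ?r = "card (B - {v})"
  let ?b = "e(0 := v)"
  have split: "{..?r} = insert 0 {1..?r}"
    by auto
  have bij: "bij_betw ?b {1..?r} (B - {v})"
    by (rule iffD2[OF bij_betw_cong e]) simp
  then have img: "?b ` {1..?r} = B - {v}"
    by (simp only: bij_betw_imp_surj_on)
  then have "insert (?b 0) (?b ` {1..?r}) = B"
    using B(1) by (simp only:) (simp add: insert_absorb)
  then have image: "?b ` {..?r} = B"
    by (simp only: split image_insert)
  have "?b 0 \<notin> ?b ` ({1..?r} - {0})"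
    by (subst Diff_triv) (simp_all only: img, simp_all)
  then have inj: "inj_on ?b {..?r}"
    unfolding split inj_on_insert using bij by (simp only: bij_betw_imp_inj_on simp_thms)
  have "vec.span B = \<Union>H"
    using B sub by (intro subset_antisym vec.span_minimal)
  then have coords: "homogeneous_coordinates H ?r ?b"
    unfolding homogeneous_coordinates_def image using inj B(3) by (intro conjI)
  have indep: "peval F (\<Sum>i\<le>?r. z i *s ?b i) = peval F (\<Sum>i\<le>?r. z' i *s ?b i)"
    if "\<forall>i\<in>{1..?r}. z i = z' i" for z z'
  proof -
    let ?w = "\<Sum>i\<in>{1..?r}. z i *s ?b i"
    have "?b i \<in> \<Union>H" if "i \<in> {1..?r}" for i
      using B(2) img that by blast
    then have "?w \<in> \<Union>H"
      using sub by (intro vec.subspace_sum vec.subspace_scale)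
    then have "?w + t *s v \<in> \<Union>H" for t
      using sub v by (intro vec.subspace_add vec.subspace_scale)
    then have const: "peval F (?w + t *s v) = peval F ?w" for t
      by (intro peval_line_constant D[rule_format])
    have "(\<Sum>i\<le>?r. z i *s ?b i) = ?w + z 0 *s v"
      unfolding split by (simp add: add.commute)
    moreover have "(\<Sum>i\<le>?r. z' i *s ?b i) = ?w + z' 0 *s v"
      unfolding split using that by (simp add: add.commute)
    ultimately show ?thesis
      by (simp only: const)
  qed
  show ?L
    unfolding cone_with_vertex_containing_def
    by (intro exI[of _ m] exI[of _ F] exI[of _ ?r] exI[of _ ?b] conjI allI impI F coords indep) simp_all
qed

section \<open>The symplectic form and polar points\<close>

text \<open>The covector \<open>\<omega>(v, \<cdot>)\<close>, which is the gradient of the linear form with polar vector \<open>v\<close>. The name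
  \<open>symplectic\<close> also serves for the Poisson bivector on covectors, which has the same matrix.\<close>

definition symplectic_dual :: "complex ^ ('n::finite + 'n) \<Rightarrow> complex ^ ('n + 'n)" where
  "symplectic_dual v = (\<chi> k. case k of Inl i \<Rightarrow> - v $ Inr i | Inr i \<Rightarrow> v $ Inl i)"

lemma sum_UNIV_sum_type:
  fixes f :: "'n::finite + 'n \<Rightarrow> complex"
  shows "(\<Sum>k\<in>UNIV. f k) = (\<Sum>i\<in>UNIV. f (Inl i) + f (Inr i))"
  by (simp add: UNIV_Plus_UNIV[symmetric] sum.Plus sum.distrib del: UNIV_Plus_UNIV)

lemma scalar_product_symplectic_dual: "scalar_product (symplectic_dual v) w = symplectic v w"
  by (simp add: scalar_product_def sum_UNIV_sum_type symplectic_def symplectic_dual_def)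

text \<open>Here the outer \<open>symplectic\<close> is the bivector: contracting it with \<open>\<omega>(v, \<cdot>)\<close> returns \<open>v\<close>, up to
  sign, which is why the bracket with \<open>\<omega>(v, \<cdot>)\<close> differentiates along \<open>v\<close>.\<close>

lemma symplectic_symplectic_dual: "symplectic (symplectic_dual v) w = - scalar_product v w"
  by (simp add: scalar_product_def sum_UNIV_sum_type symplectic_def symplectic_dual_def
      sum_negf[symmetric] minus_diff_commute del: sum_negf)

lemma symplectic_dual_scale: "symplectic_dual (c *s v) = c *s symplectic_dual v"
  by (auto simp: vec_eq_iff symplectic_dual_def split: sum.split)

lemma symplectic_dual_inject: "symplectic_dual u = symplectic_dual v \<longleftrightarrow> u = v"
proof
  assume eq: "symplectic_dual u = symplectic_dual v"
  have "u $ k = v $ k" for k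
    using arg_cong[OF eq, of "\<lambda>a. a $ Inl (projr k)"] arg_cong[OF eq, of "\<lambda>a. a $ Inr (projl k)"]
    by (cases k) (simp_all add: symplectic_dual_def)
  then show "u = v"
    by (simp add: vec_eq_iff)
qed simp

lemma symplectic_dual_eq_zero_iff: "symplectic_dual v = 0 \<longleftrightarrow> v = 0"
proof -
  have "symplectic_dual 0 = (0 :: complex ^ ('a + 'a))"
    by (auto simp: vec_eq_iff symplectic_dual_def split: sum.split)
  then show ?thesis
    using symplectic_dual_inject[of v 0] by simp
qed

lemma symplectic_dual_surj: obtains v where "symplectic_dual v = a"
proof
  show "symplectic_dual (\<chi> k. case k of Inl i \<Rightarrow> a $ Inr i | Inr i \<Rightarrow> - a $ Inl i) = a"
    by (auto simp: vec_eq_iff symplectic_dual_def split: sum.split)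
qed

lemma symplectic_self: "symplectic v v = 0"
  by (simp add: symplectic_def mult.commute)

lemma symplectic_add_scale:
  "symplectic (x *s a + y *s b) (z *s a + w *s b) = (x * w - y * z) * symplectic a b"
proof -
  have "symplectic (x *s a + y *s b) (z *s a + w *s b)
      = (\<Sum>i\<in>UNIV. (x * w - y * z) * (a $ Inl i * b $ Inr i - a $ Inr i * b $ Inl i))"
    unfolding symplectic_def by (intro sum.cong refl) (simp add: algebra_simps)
  then show ?thesis
    by (simp add: symplectic_def sum_distrib_left)
qed

lemma peval_poisson: "peval (poisson f g) u = symplectic (gradient f u) (gradient g u)"
  by (simp add: poisson_def symplectic_def gradient_def peval_sum peval_diff peval_mult)

lemma gradient_symplectic_form:
  assumes "\<And>u. peval l u = symplectic v u"
  shows "gradient l u = symplectic_dual v"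
proof (rule gradient_eqI)
  fix w
  show "((\<lambda>t. peval l (u + t *s w)) has_field_derivative scalar_product (symplectic_dual v) w) (at 0)"
    by (auto simp: assms scalar_product_symplectic_dual[symmetric] scalar_product_add_scale
        intro!: derivative_eq_intros)
qed

text \<open>A function that is homogeneous of degree one agrees with its derivative at the origin, and every
  covector has the form \<open>\<omega>(v, \<cdot>)\<close> because \<open>\<omega>\<close> is nondegenerate.\<close>

lemma linear_form_symplectic:
  fixes l :: "('n::finite + 'n) cpoly"
  assumes "form 1 l"
  obtains v where "\<And>u. peval l u = symplectic v u"
proof -
  obtain v where v: "symplectic_dual v = gradient l 0"
    by (rule symplectic_dual_surj)
  have "peval l u = symplectic v u" for u
  proof (rule DERIV_unique)
    show "((\<lambda>t. peval l (0 + t *s u)) has_field_derivative symplectic v u) (at 0)"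
      using directional_derivative_at_base[of l 0 u]
      by (simp only: v[symmetric] scalar_product_symplectic_dual)
    show "((\<lambda>t. peval l (0 + t *s u)) has_field_derivative peval l u) (at 0)"
      by (auto simp: peval_scale_form[OF assms] intro!: derivative_eq_intros)
  qed
  then show ?thesis by (rule that)
qed

lemma Union_zero_locus_linear_form:
  assumes l: "\<And>u. peval l u = symplectic v u" and "v \<noteq> 0"
  shows "\<Union>(zero_locus {l}) = {u. symplectic v u = 0}"
proof (intro subset_antisym subsetI)
  fix u assume "u \<in> {u. symplectic v u = 0}"
  then have u: "symplectic v u = 0" by simp
  have line: "proj_point w \<in> zero_locus {l}" if "w \<noteq> 0" "symplectic v w = 0" for w
  proof -
    have "symplectic v (c *s w) = 0" for c
      using scalar_product_add_scale[of "symplectic_dual v" 0 c w] that(2)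
      by (simp add: scalar_product_symplectic_dual) (simp add: symplectic_def)
    then show ?thesis
      using that(1) by (auto simp: zero_locus_def proj_space_def proj_point_def vec.span_singleton l)
  qed
  show "u \<in> \<Union>(zero_locus {l})"
  proof (cases "u = 0")
    case True
    \<comment> \<open>The origin lies on every line, so any point of the hyperplane serves; the polar point is one.\<close>
    have "proj_point v \<in> zero_locus {l}"
      using line \<open>v \<noteq> 0\<close> symplectic_self by blast
    moreover have "u \<in> proj_point v"
      by (simp add: True proj_point_def vec.span_zero)
    ultimately show ?thesis by blast
  next
    case False
    moreover have "u \<in> proj_point u"
      by (simp add: proj_point_def vec.span_base)
    ultimately show ?thesis
      using line u by blast
  qed
qed (auto simp: zero_locus_def l)

lemma proj_point_scale:
  assumes "c \<noteq> 0"
  shows "proj_point (c *s v) = proj_point v"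
proof -
  have "k *s v \<in> range (\<lambda>x. x *s (c *s v))" for k
    using assms by (intro range_eqI[of _ _ "k / c"]) simp
  then show ?thesis
    by (auto simp: proj_point_def vec.span_singleton)
qed

text \<open>The kernel determines a nonzero covector up to a scalar, so the polar point depends on the
  hyperplane and not on the linear form chosen to define it.\<close>

lemma polar_point_unique:
  assumes "v \<noteq> 0" "v' \<noteq> 0" and ker: "{u. symplectic v u = 0} = {u. symplectic v' u = 0}"
  shows "proj_point v' = proj_point v"
proof -
  have "symplectic_dual v \<noteq> 0"
    using \<open>v \<noteq> 0\<close> by (simp add: symplectic_dual_eq_zero_iff)
  moreover have "scalar_product (symplectic_dual v') w = 0" if "scalar_product (symplectic_dual v) w = 0" for w
    using that ker by (auto simp: scalar_product_symplectic_dual)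
  ultimately obtain c where "symplectic_dual v' = c *s symplectic_dual v"
    using covector_proportional by blast
  then have v': "v' = c *s v"
    by (simp add: symplectic_dual_scale[symmetric] symplectic_dual_inject)
  then have "c \<noteq> 0"
    using \<open>v' \<noteq> 0\<close> by auto
  then show ?thesis
    unfolding v' by (rule proj_point_scale)
qed

lemma hyperplane_polar_pointE:
  fixes H :: "(complex ^ ('n::finite + 'n)) set set"
  assumes "hyperplane H"
  obtains l v where "l \<in> vanishing_ideal H" and "\<And>u. peval l u = symplectic v u" and "v \<noteq> 0"
    and "\<Union>H = {u. symplectic v u = 0}" and "polar_point H = proj_point v"
proof -
  have nonzero: "v \<noteq> 0" if l: "form 1 l" "l \<noteq> 0" and v: "\<forall>u. peval l u = symplectic v u"
    for l :: "('n + 'n) cpoly" and v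
  proof
    obtain u where "peval l u \<noteq> 0"
      using linear_form_nonzero_value[OF l] .
    moreover assume "v = 0"
    ultimately show False
      using v by (simp add: symplectic_def)
  qed
  obtain l where l: "form 1 l" "l \<noteq> 0" "H = zero_locus {l}"
    using assms by (auto simp: hyperplane_def)
  obtain v where v: "\<And>u. peval l u = symplectic v u"
    using linear_form_symplectic[OF l(1)] by blast
  then have "v \<noteq> 0"
    using nonzero l(1,2) by blast
  have ker: "\<Union>H = {u. symplectic v u = 0}"
    unfolding l(3) using v \<open>v \<noteq> 0\<close> by (rule Union_zero_locus_linear_form)
  have "polar_point H = proj_point v"
    unfolding polar_point_def
  proof (rule the_equality)
    show "\<exists>l v'. form 1 l \<and> l \<noteq> 0 \<and> H = zero_locus {l} \<and>
        (\<forall>u. peval l u = symplectic v' u) \<and> proj_point v = proj_point v'"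
      using l v by blast
  next
    fix p
    assume "\<exists>l v'. form 1 l \<and> l \<noteq> 0 \<and> H = zero_locus {l} \<and>
        (\<forall>u. peval l u = symplectic v' u) \<and> p = proj_point v'"
    then obtain l' v' where l': "form 1 l'" "l' \<noteq> 0" "H = zero_locus {l'}"
      and v': "\<forall>u. peval l' u = symplectic v' u" and p: "p = proj_point v'"
      by blast
    have "v' \<noteq> 0"
      using nonzero l'(1,2) v' by blast
    moreover have "\<Union>H = {u. symplectic v' u = 0}"
      unfolding l'(3) using v' \<open>v' \<noteq> 0\<close> by (intro Union_zero_locus_linear_form) auto
    ultimately show "p = proj_point v"
      unfolding p using \<open>v \<noteq> 0\<close> ker by (intro polar_point_unique) auto
  qed
  moreover have "l \<in> vanishing_ideal H"
    by (auto simp: vanishing_ideal_def l(3) zero_locus_def)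
  ultimately show ?thesis
    using that v \<open>v \<noteq> 0\<close> ker by blast
qed

lemma peval_poisson_linear_form:
  assumes "\<And>u. peval l u = symplectic v u"
  shows "peval (poisson l f) u = - scalar_product (gradient f u) v"
  by (simp add: peval_poisson gradient_symplectic_form[OF assms] symplectic_symplectic_dual
      scalar_product_commute)

section \<open>Involutivity and the derivative along the polar point\<close>

text \<open>This is the first-order trace of the fact that \<open>l\<close> generates the ideal of \<open>H\<close>: a polynomial
  that vanishes on \<open>H\<close> is stationary in all directions of \<open>H\<close>.\<close>

lemma gradient_vanishing_on_hyperplane:
  assumes ker: "\<Union>H = {u. symplectic v u = 0}" and "v \<noteq> 0"
    and g: "g \<in> vanishing_ideal H" and u: "u \<in> \<Union>H"
  obtains c where "gradient g u = c *s symplectic_dual v"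
proof (rule covector_proportional)
  show "symplectic_dual v \<noteq> 0"
    using \<open>v \<noteq> 0\<close> by (simp add: symplectic_dual_eq_zero_iff)
next
  fix w assume w: "scalar_product (symplectic_dual v) w = 0"
  show "scalar_product (gradient g u) w = 0"
  proof (rule directional_derivative_eq_zeroI)
    fix t
    have "u + t *s w \<in> \<Union>H"
      using u w by (simp add: ker scalar_product_symplectic_dual[symmetric] scalar_product_add_scale)
    then show "peval g (u + t *s w) = 0"
      using g by (auto simp: vanishing_ideal_def)
  qed
qed (rule that)

text \<open>Bracketing with the equation of \<open>H\<close> shows that \<open>\<partial>\<^sub>v F\<close> is a multiple of \<open>F\<close> on \<open>H\<close>; being of
  lower degree than \<open>F\<close>, it vanishes there.\<close>

lemma involutive_imp_directional_derivative_zero: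
  assumes inv: "involutive X" and "X \<subseteq> H" and F: "hypersurface_equation H X m F"
    and lH: "l \<in> vanishing_ideal H" and l: "\<And>u. peval l u = symplectic v u"
    and ker: "\<Union>H = {u. symplectic v u = 0}" and u: "u \<in> \<Union>H"
  shows "scalar_product (gradient F u) v = 0"
proof -
  have "l \<in> vanishing_ideal X"
    using lH \<open>X \<subseteq> H\<close> by (auto simp: vanishing_ideal_def)
  moreover have "F \<in> vanishing_ideal X"
    using F by (auto simp: hypersurface_equation_def vanishing_ideal_def zero_locus_def)
  ultimately have "poisson l F \<in> vanishing_ideal X"
    using inv by (simp add: involutive_def)
  then obtain g h where gh: "poisson l F = g + h * F" and g: "g \<in> vanishing_ideal H"
    using F by (auto simp: hypersurface_equation_def)
  have "scalar_product (gradient F (t *s u)) v = peval (- h) (t *s u) * peval F (t *s u)" for t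
  proof -
    have "t *s u \<in> \<Union>H"
      using u scalar_product_add_scale[of "symplectic_dual v" 0 t u]
      by (simp add: ker scalar_product_symplectic_dual) (simp add: symplectic_def)
    then have "peval g (t *s u) = 0"
      using g by (auto simp: vanishing_ideal_def)
    then have "- scalar_product (gradient F (t *s u)) v = peval h (t *s u) * peval F (t *s u)"
      using peval_poisson_linear_form[OF l, of F "t *s u"] by (simp add: gh peval_add peval_mult)
    then have "scalar_product (gradient F (t *s u)) v = - (peval h (t *s u) * peval F (t *s u))"
      by (metis minus_minus)
    then show ?thesis
      using peval_diff[of 0 h "t *s u"] by simp
  qed
  moreover have "form m F"
    using F by (simp add: hypersurface_equation_def)
  ultimately show ?thesis
    using directional_derivative_eq_zero_if_multiple by blast
qed

text \<open>At a point of \<open>X\<close> the gradient of any element of the ideal is a combination of \<open>\<omega>(v, \<cdot>)\<close> and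
  the gradient of \<open>F\<close>, so every bracket there is a multiple of \<open>\<partial>\<^sub>v F\<close>.\<close>

lemma directional_derivative_zero_imp_involutive:
  assumes F: "hypersurface_equation H X m F" and ker: "\<Union>H = {u. symplectic v u = 0}" and "v \<noteq> 0"
    and D: "\<And>u. u \<in> \<Union>H \<Longrightarrow> scalar_product (gradient F u) v = 0"
  shows "involutive X"
proof -
  have grad: "\<exists>c d. gradient f u = c *s symplectic_dual v + d *s gradient F u"
    if f: "f \<in> vanishing_ideal X" and u: "u \<in> \<Union>X" for f u
  proof -
    have uH: "u \<in> \<Union>H" and Fu: "peval F u = 0"
      using F u by (auto simp: hypersurface_equation_def zero_locus_def)
    obtain g h where gh: "f = g + h * F" and g: "g \<in> vanishing_ideal H"
      using F f by (auto simp: hypersurface_equation_def)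
    obtain c where "gradient g u = c *s symplectic_dual v"
      using gradient_vanishing_on_hyperplane[OF ker \<open>v \<noteq> 0\<close> g uH] .
    then have "gradient f u = c *s symplectic_dual v + peval h u *s gradient F u"
      by (simp add: gh gradient_add gradient_mult Fu)
    then show ?thesis by blast
  qed
  have "peval (poisson f g) u = 0"
    if f: "f \<in> vanishing_ideal X" and g: "g \<in> vanishing_ideal X" and u: "u \<in> \<Union>X" for f g u
  proof -
    have "symplectic (symplectic_dual v) (gradient F u) = 0"
      using D F u by (auto simp: symplectic_symplectic_dual scalar_product_commute[of v]
          hypersurface_equation_def)
    then show ?thesis
      using grad[OF f u] grad[OF g u] by (auto simp: peval_poisson symplectic_add_scale)
  qed
  then show ?thesis
    by (auto simp: involutive_def vanishing_ideal_def[of X])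
qed

theorem theorem3p2:
  fixes X H :: "(complex ^ ('n::finite + 'n)) set set" and m :: nat
  assumes "CARD('n) \<ge> 2"
    and "proj_variety X" and "has_codim X 2"
    and "hyperplane H" and "X \<subseteq> H"
    and "hypersurface_of_degree H X m" and "m \<ge> 2"
  shows "involutive X \<longleftrightarrow> cone_with_vertex_containing H X (polar_point H)"
proof -
  obtain l v where lH: "l \<in> vanishing_ideal H" and l: "\<And>u. peval l u = symplectic v u"
    and "v \<noteq> 0" and ker: "\<Union>H = {u. symplectic v u = 0}" and polar: "polar_point H = proj_point v"
    using hyperplane_polar_pointE[OF \<open>hyperplane H\<close>] by metis
  obtain F where F: "hypersurface_equation H X m F"
    using \<open>hypersurface_of_degree H X m\<close> by (auto simp: hypersurface_of_degree_def)
  have "vec.subspace (\<Union>H)"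
    unfolding ker vec.subspace_def
    by (simp add: symplectic_def algebra_simps sum.distrib sum_subtractf sum_distrib_left[symmetric]
        mult.left_commute)
  then have "cone_with_vertex_containing H X (polar_point H) \<longleftrightarrow>
      (\<exists>m F. hypersurface_equation H X m F \<and> (\<forall>u\<in>\<Union>H. scalar_product (gradient F u) v = 0))"
    unfolding polar using \<open>v \<noteq> 0\<close> by (intro cone_iff_directional_derivative_zero) (simp_all add: ker symplectic_self)
  also have "\<dots> \<longleftrightarrow> involutive X"
    using involutive_imp_directional_derivative_zero[OF _ \<open>X \<subseteq> H\<close> F lH l ker] F
      directional_derivative_zero_imp_involutive[OF _ ker \<open>v \<noteq> 0\<close>]
    by blast
  finally show ?thesis by blast
qed

end
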